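(* Let $n\ge 2$. For $0<\varepsilon<1$ consider the annulus $\Omega_\varepsilon:=\{x\in\mathbb R^n : \varepsilon<|x|<1\}$. Then for every constant $h>0$ there exists some $\varepsilon=\varepsilon(h)\in(0,1)$ such that there is no function $f\in C^2(\Omega_\varepsilon,\mathbb R)\cap C^0(\overline{\Omega_\varepsilon},\mathbb R)$ whose graph has constant mean curvature $h$ and which has zero boundary values, i.e. no such $f$ with $$\operatorname{div}\frac{\nabla f}{\sqrt{1+|\nabla f|^2}}=nh\quad\text{in }\Omega_\varepsilon,\qquad f=0\quad\text{on }\partial\Omega_\varepsilon.$$
   Context: The graph of $f$ over $\Omega\subset\mathbb R^n$ has constant mean curvature $h$ if $\operatorname{div}\frac{\nabla f}{\sqrt{1+|\nabla f|^2}}=nh$ in $\Omega$. *)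

theory Defs
  imports "HOL-Analysis.Analysis"
begin

definition annulus :: "real \<Rightarrow> (real ^ 'n) set"
  where "annulus \<epsilon> = {x. \<epsilon> < norm x \<and> norm x < 1}"

text \<open>Entrywise partial derivatives; \<open>gradient\<close> and \<open>divergence\<close> are meaningful only at points where
  the argument is differentiable, since \<open>frechet_derivative\<close> is arbitrary elsewhere.\<close>

definition gradient :: "(real ^ 'n \<Rightarrow> real) \<Rightarrow> real ^ 'n \<Rightarrow> real ^ 'n"
  where "gradient f x = (\<chi> i. frechet_derivative f (at x) (axis i 1))"

definition divergence :: "(real ^ 'n \<Rightarrow> real ^ 'n) \<Rightarrow> real ^ 'n \<Rightarrow> real"
  where "divergence F x = (\<Sum>i\<in>UNIV. frechet_derivative F (at x) (axis i 1) $ i)"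

text \<open>The class \<open>C\<^sup>2\<close> on \<open>S\<close>, intended for open \<open>S\<close>: \<open>D\<close> and \<open>D2\<close> are the first and second
  Frechet derivatives. Continuity of \<open>f\<close> and \<open>D\<close> on \<open>S\<close> is implied by differentiability.\<close>

definition C2_on :: "(real ^ 'n \<Rightarrow> real) \<Rightarrow> (real ^ 'n) set \<Rightarrow> bool"
  where "C2_on f S \<longleftrightarrow>
    (\<exists>(D :: real ^ 'n \<Rightarrow> ((real ^ 'n) \<Rightarrow>\<^sub>L real))
       (D2 :: real ^ 'n \<Rightarrow> ((real ^ 'n) \<Rightarrow>\<^sub>L ((real ^ 'n) \<Rightarrow>\<^sub>L real))).
      (\<forall>x\<in>S. (f has_derivative blinfun_apply (D x)) (at x)) \<and>
      (\<forall>x\<in>S. (D has_derivative blinfun_apply (D2 x)) (at x)) \<and>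
      continuous_on S D2)"

definition graph_has_constant_mean_curvature ::
    "(real ^ 'n \<Rightarrow> real) \<Rightarrow> (real ^ 'n) set \<Rightarrow> real \<Rightarrow> bool"
  where "graph_has_constant_mean_curvature f S h \<longleftrightarrow>
    (\<forall>x\<in>S. divergence (\<lambda>y. gradient f y /\<^sub>R sqrt (1 + (norm (gradient f y))\<^sup>2)) x
            = real CARD('n) * h)"

end

theory Submission
  imports Defs "HOL-Real_Asymp.Real_Asymp"
begin

text \<open>
  Finn's argument: for \<open>a > \<epsilon>\<close> compare \<open>f\<close> on \<open>a \<le> |x| \<le> 1\<close> with a radial strict
  supersolution \<open>v\<close> that vanishes on \<open>|x| = 1\<close> and has slope \<open>-\<infinity>\<close> at \<open>|x| = a\<close>. The maximum of
  \<open>f - v\<close> is not attained on \<open>|x| = a\<close>, where \<open>f\<close> is differentiable, nor in the interior, so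
  \<open>f \<le> v\<close> without any hypothesis on \<open>f\<close> along \<open>|x| = a\<close>. As \<open>v\<close> is a paraboloid \<open>k (|x|\<^sup>2 - 1) / 2\<close>
  minus a catenoid whose height tends to \<open>0\<close> with \<open>a\<close>, it is below \<open>-k / 4\<close> on \<open>|x| = a\<close> for
  small \<open>a\<close>. Letting \<open>a\<close> decrease to \<open>\<epsilon>\<close> contradicts \<open>f = 0\<close> on \<open>|x| = \<epsilon>\<close>.
\<close>

section \<open>First- and second-order conditions at a maximum\<close>

lemma second_derivative_nonpos_at_local_max:
  fixes g :: "real \<Rightarrow> real"
  assumes "d > 0"
    and g: "\<And>t. \<bar>t\<bar> < d \<Longrightarrow> (g has_real_derivative g' t) (at t)"
    and g': "(g' has_real_derivative L) (at 0)"
    and max: "\<And>t. \<bar>t\<bar> < d \<Longrightarrow> g t \<le> g 0"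
  shows "g' 0 = 0" "L \<le> 0"
proof -
  show 0: "g' 0 = 0"
    using DERIV_local_max[OF g[of 0] \<open>d > 0\<close>] max \<open>d > 0\<close> by auto
  show "L \<le> 0"
  proof (rule ccontr)
    assume "\<not> L \<le> 0"
    \<comment> \<open>If \<open>g'\<close> had positive derivative at its zero, it would be positive
      just to the right of 0, and \<open>g\<close> would increase strictly there.\<close>
    then obtain e where e: "e > 0" "\<And>t. 0 < t \<Longrightarrow> t < e \<Longrightarrow> g' 0 < g' t"
      using DERIV_pos_inc_right[OF g'] by auto
    define t where "t = min d e / 2"
    have t: "0 < t" "t < d" "t < e" using \<open>d > 0\<close> \<open>e > 0\<close> by (auto simp: t_def)
    have "g 0 < g t"
    proof (rule DERIV_pos_imp_increasing_open[OF \<open>0 < t\<close>])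
      fix x assume x: "0 < x" "x < t"
      then show "\<exists>y. DERIV g x :> y \<and> 0 < y"
        using g[of x] e(2)[of x] t 0 by (intro exI[of _ "g' x"]) auto
    next
      show "continuous_on {0..t} g"
        using t by (intro continuous_at_imp_continuous_on ballI DERIV_isCont[OF g]) auto
    qed
    with max[of t] t show False by auto
  qed
qed

text \<open>The one-variable test is applied along the line through \<open>x0\<close> in direction
  \<xi>. With q = |x|^2, the factor 1/2 in the hypothesis on \<open>W\<close> cancels the 2 in the
  derivative of q: the radial function W(|x|^2) has gradient s x and Hessian s I + 2 s' x
  x^T.\<close>

lemma touching_from_above_by_radial:
  fixes f W s :: "_ \<Rightarrow> real" and x0 \<xi> :: "'a :: euclidean_space"
    and D :: "'a \<Rightarrow> 'a \<Rightarrow>\<^sub>L real" and D2 :: "'a \<Rightarrow>\<^sub>L 'a \<Rightarrow>\<^sub>L real"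
  assumes S: "open S" "x0 \<in> S"
    and f: "\<And>x. x \<in> S \<Longrightarrow> (f has_derivative blinfun_apply (D x)) (at x)"
    and D: "(D has_derivative blinfun_apply D2) (at x0)"
    and W: "\<And>x. x \<in> S \<Longrightarrow> (W has_real_derivative s (x \<bullet> x) / 2) (at (x \<bullet> x))"
    and s: "(s has_real_derivative s') (at (x0 \<bullet> x0))"
    and max: "\<And>x. x \<in> S \<Longrightarrow> f x - W (x \<bullet> x) \<le> f x0 - W (x0 \<bullet> x0)"
  shows "D x0 \<xi> = s (x0 \<bullet> x0) * (x0 \<bullet> \<xi>)"
    and "D2 \<xi> \<xi> \<le> 2 * s' * (x0 \<bullet> \<xi>)\<^sup>2 + s (x0 \<bullet> x0) * (\<xi> \<bullet> \<xi>)"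
proof -
  define l where "l t = x0 + t *\<^sub>R \<xi>" for t
  have l0 [simp]: "l 0 = x0" by (simp add: l_def)
  have l: "(l has_derivative (\<lambda>t. t *\<^sub>R \<xi>)) (at t)" for t
    unfolding l_def by (auto intro!: derivative_eq_intros)
  have "\<forall>\<^sub>F t in at 0. l t \<in> S"
  proof (rule topological_tendstoD)
    show "(l \<longlongrightarrow> x0) (at 0)" unfolding l_def by (auto intro!: tendsto_eq_intros)
  qed (use S in auto)
  then obtain d where d: "d > 0" "\<And>t. t \<noteq> 0 \<Longrightarrow> \<bar>t\<bar> < d \<Longrightarrow> l t \<in> S"
    by (auto simp: eventually_at dist_real_def)
  have lS: "l t \<in> S" if "\<bar>t\<bar> < d" for t
    using d(2)[of t] that S by (cases "t = 0") auto
  define Q where "Q t = l t \<bullet> l t" for t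
  have Q_eq: "Q t = x0 \<bullet> x0 + 2 * t * (x0 \<bullet> \<xi>) + t\<^sup>2 * (\<xi> \<bullet> \<xi>)" for t
    by (simp add: Q_def l_def inner_simps inner_commute power2_eq_square algebra_simps)
  have Q: "(Q has_real_derivative 2 * (x0 \<bullet> \<xi>) + 2 * t * (\<xi> \<bullet> \<xi>)) (at t)" for t
    unfolding Q_eq[abs_def] by (auto intro!: derivative_eq_intros)
  define g where "g t = f (l t) - W (Q t)" for t
  define g' where "g' t = D (l t) \<xi> - s (Q t) / 2 * (2 * (x0 \<bullet> \<xi>) + 2 * t * (\<xi> \<bullet> \<xi>))" for t
  have fl: "((\<lambda>t. f (l t)) has_real_derivative D (l t) \<xi>) (at t)" if "\<bar>t\<bar> < d" for t
    using has_derivative_compose[OF l f[OF lS[OF that]]]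
    by (simp add: has_field_derivative_def blinfun.scaleR_right mult_commute_abs)
  have Dl: "((\<lambda>t. D (l t) \<xi>) has_real_derivative D2 \<xi> \<xi>) (at 0)"
  proof -
    have "((\<lambda>t. D (l t)) has_derivative (\<lambda>t. D2 (t *\<^sub>R \<xi>))) (at 0)"
      using has_derivative_compose[OF l, of D D2 0] D by simp
    from has_derivative_compose[OF this bounded_linear_imp_has_derivative[OF blinfun.bounded_linear_left]]
    show ?thesis
      by (simp add: has_field_derivative_def blinfun.scaleR_right blinfun.scaleR_left mult_commute_abs)
  qed
  have g: "(g has_real_derivative g' t) (at t)" if "\<bar>t\<bar> < d" for t
  proof -
    have "(W has_real_derivative s (Q t) / 2) (at (Q t))"
      using W[OF lS[OF that]] by (simp add: Q_def)
    from DERIV_diff[OF fl[OF that] DERIV_chain2[OF this Q]] show ?thesis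
      unfolding g_def g'_def .
  qed
  have sQ: "((\<lambda>t. s (Q t)) has_real_derivative s' * (2 * (x0 \<bullet> \<xi>))) (at 0)"
    using DERIV_chain2[OF _ Q, of s s' 0] s by (simp add: Q_def)
  have "(g' has_real_derivative
      D2 \<xi> \<xi> - (2 * s' * (x0 \<bullet> \<xi>)\<^sup>2 + s (x0 \<bullet> x0) * (\<xi> \<bullet> \<xi>))) (at 0)"
  proof -
    have "((\<lambda>t. 2 * (x0 \<bullet> \<xi>) + 2 * t * (\<xi> \<bullet> \<xi>)) has_real_derivative 2 * (\<xi> \<bullet> \<xi>)) (at 0)"
      by (auto intro!: derivative_eq_intros)
    from DERIV_diff[OF Dl DERIV_mult[OF DERIV_cdivide[OF sQ, of 2] this]] show ?thesis
      unfolding g'_def by (rule DERIV_cong) (simp add: Q_def power2_eq_square algebra_simps)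
  qed
  from second_derivative_nonpos_at_local_max[OF d(1) g this]
  have "g' 0 = 0" "D2 \<xi> \<xi> - (2 * s' * (x0 \<bullet> \<xi>)\<^sup>2 + s (x0 \<bullet> x0) * (\<xi> \<bullet> \<xi>)) \<le> 0"
    using max[OF lS] by (auto simp: g_def Q_def)
  then show "D x0 \<xi> = s (x0 \<bullet> x0) * (x0 \<bullet> \<xi>)"
    and "D2 \<xi> \<xi> \<le> 2 * s' * (x0 \<bullet> \<xi>)\<^sup>2 + s (x0 \<bullet> x0) * (\<xi> \<bullet> \<xi>)"
    by (auto simp: g'_def Q_def)
qed

section \<open>The mean curvature operator at a touching point\<close>

lemma sum_axis_component:
  fixes p :: "real ^ 'n"
  shows "(\<Sum>i\<in>UNIV. p $ i *\<^sub>R axis i 1) = p"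
  by (simp add: vec_eq_iff axis_def if_distrib cong: if_cong)

text \<open>The vectors \<open>e\<^sub>i - \<beta> p\<^sub>i p\<close> are the columns of a square root of \<open>I - c p p\<^sup>T\<close>, where
  \<open>c = 2 \<beta> - \<beta>\<^sup>2 |p|\<^sup>2\<close>; so no symmetry of \<open>B\<close> is needed to test it on these vectors.\<close>

lemma trace_rank_one_perturbation:
  fixes B :: "(real ^ 'n) \<Rightarrow>\<^sub>L (real ^ 'n) \<Rightarrow>\<^sub>L real" and p :: "real ^ 'n"
  defines "v \<equiv> (\<lambda>\<beta> i. axis i 1 - (\<beta> * p $ i) *\<^sub>R p)"
  shows "(\<Sum>i\<in>UNIV. B (v \<beta> i) (v \<beta> i)) =
    (\<Sum>i\<in>UNIV. B (axis i 1) (axis i 1)) - (2 * \<beta> - \<beta>\<^sup>2 * (p \<bullet> p)) * B p p"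
proof -
  have 1: "(\<Sum>i\<in>UNIV. p $ i * B (axis i 1) p) = B p p"
  proof -
    have "B p p = B (\<Sum>i\<in>UNIV. p $ i *\<^sub>R axis i 1) p" by (simp add: sum_axis_component)
    also have "\<dots> = (\<Sum>i\<in>UNIV. p $ i * B (axis i 1) p)"
      by (simp add: blinfun.sum_right blinfun.sum_left blinfun.scaleR_right blinfun.scaleR_left)
    finally show ?thesis by simp
  qed
  have 2: "(\<Sum>i\<in>UNIV. p $ i * B p (axis i 1)) = B p p"
  proof -
    have "B p p = B p (\<Sum>i\<in>UNIV. p $ i *\<^sub>R axis i 1)" by (simp add: sum_axis_component)
    also have "\<dots> = (\<Sum>i\<in>UNIV. p $ i * B p (axis i 1))"
      by (simp add: blinfun.sum_right blinfun.scaleR_right)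
    finally show ?thesis by simp
  qed
  have 3: "(\<Sum>i\<in>UNIV. p $ i * p $ i) = p \<bullet> p" by (simp add: inner_vec_def)
  have "B (v \<beta> i) (v \<beta> i) = B (axis i 1) (axis i 1) - \<beta> * (p $ i * B (axis i 1) p)
      - \<beta> * (p $ i * B p (axis i 1)) + \<beta>\<^sup>2 * (p $ i * p $ i) * B p p" for i
    by (simp add: v_def blinfun.diff_right blinfun.diff_left blinfun.scaleR_right
        blinfun.scaleR_left algebra_simps power2_eq_square)
  then show ?thesis
    by (simp add: sum.distrib sum_subtractf 1 2 3 flip: sum_distrib_left sum_distrib_right)
      (simp add: algebra_simps)
qed

text \<open>Nondivergence form of the operator: the quotient rule turns the divergence, times
  \<open>w\<close>, into the trace of the Hessian against I - p p^T / w^2.\<close>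

lemma divergence_unit_normal:
  fixes f :: "real ^ 'n \<Rightarrow> real"
    and D :: "(real ^ 'n) \<Rightarrow> (real ^ 'n) \<Rightarrow>\<^sub>L real" and D2 :: "(real ^ 'n) \<Rightarrow>\<^sub>L (real ^ 'n) \<Rightarrow>\<^sub>L real"
  assumes S: "open S" "x0 \<in> S"
    and f: "\<And>x. x \<in> S \<Longrightarrow> (f has_derivative blinfun_apply (D x)) (at x)"
    and D: "(D has_derivative blinfun_apply D2) (at x0)"
  defines "p \<equiv> gradient f x0"
  defines "w \<equiv> sqrt (1 + p \<bullet> p)"
  shows "w * divergence (\<lambda>y. gradient f y /\<^sub>R sqrt (1 + (norm (gradient f y))\<^sup>2)) x0 =
    (\<Sum>i\<in>UNIV. D2 (axis i 1) (axis i 1)) - D2 p p / w\<^sup>2"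
proof -
  define G where "G y = (\<chi> i. D y (axis i 1))" for y
  define H where "H \<xi> = (\<chi> i. D2 \<xi> (axis i 1))" for \<xi>
  have grad: "gradient f y = G y" if "y \<in> S" for y
    using frechet_derivative_at[OF f[OF that]] by (simp add: gradient_def G_def)
  have p: "p = G x0" using grad S by (simp add: p_def)
  have w: "w > 0" "w\<^sup>2 = 1 + p \<bullet> p"
    unfolding w_def by (auto intro!: add_pos_nonneg)
  have G: "(G has_derivative H) (at x0)"
  proof (subst has_derivative_componentwise_within, intro ballI)
    fix b :: "real ^ 'n" assume "b \<in> Basis"
    then obtain i where b: "b = axis i 1" by (auto simp: Basis_vec_def)
    have "((\<lambda>y. D y (axis i 1)) has_derivative (\<lambda>\<xi>. D2 \<xi> (axis i 1))) (at x0)"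
      by (rule has_derivative_compose[OF D bounded_linear_imp_has_derivative[OF blinfun.bounded_linear_left]])
    then show "((\<lambda>x. G x \<bullet> b) has_derivative (\<lambda>x. H x \<bullet> b)) (at x0)"
      by (simp add: b inner_axis G_def H_def)
  qed
  have GG: "((\<lambda>y. 1 + G y \<bullet> G y) has_derivative (\<lambda>\<xi>. 2 * (p \<bullet> H \<xi>))) (at x0)"
    by (rule derivative_eq_intros G refl)+ (simp add: p inner_commute)
  have "((\<lambda>y. inverse (sqrt (1 + G y \<bullet> G y))) has_derivative (\<lambda>\<xi>. - (p \<bullet> H \<xi>) / w ^ 3)) (at x0)"
  proof -
    have "1 + G x0 \<bullet> G x0 > 0" by (simp add: add_pos_nonneg)
    then have "((\<lambda>u. inverse (sqrt u)) has_real_derivative - 1 / (2 * w ^ 3)) (at (1 + G x0 \<bullet> G x0))"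
      using w by (auto intro!: derivative_eq_intros
          simp: w_def p field_simps power3_eq_cube)
    from has_derivative_compose[OF GG this[unfolded has_field_derivative_def]]
    show ?thesis by (simp add: field_simps)
  qed
  from has_derivative_scaleR[OF this G]
  have "((\<lambda>y. G y /\<^sub>R sqrt (1 + (norm (G y))\<^sup>2)) has_derivative
      (\<lambda>\<xi>. H \<xi> /\<^sub>R w - ((p \<bullet> H \<xi>) / w ^ 3) *\<^sub>R p)) (at x0)"
    by (simp add: power2_norm_eq_inner w_def p)
  \<comment> \<open>\<open>gradient f\<close> is known to agree with \<open>G\<close> only on
    \<open>S\<close>; openness of \<open>S\<close> makes that enough for the derivative at
    \<open>x0\<close>.\<close>
  then have "((\<lambda>y. gradient f y /\<^sub>R sqrt (1 + (norm (gradient f y))\<^sup>2)) has_derivative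
      (\<lambda>\<xi>. H \<xi> /\<^sub>R w - ((p \<bullet> H \<xi>) / w ^ 3) *\<^sub>R p)) (at x0)"
    by (rule has_derivative_transform_within_open[OF _ S]) (simp add: grad)
  note deriv = frechet_derivative_at[OF this]
  have "divergence (\<lambda>y. gradient f y /\<^sub>R sqrt (1 + (norm (gradient f y))\<^sup>2)) x0 =
     (\<Sum>i\<in>UNIV. D2 (axis i 1) (axis i 1) / w - p $ i * (p \<bullet> H (axis i 1)) / w ^ 3)"
    unfolding divergence_def deriv[symmetric] by (simp add: H_def field_simps)
  also have "\<dots> = (\<Sum>i\<in>UNIV. D2 (axis i 1) (axis i 1)) / w
      - (\<Sum>i\<in>UNIV. p $ i * (p \<bullet> H (axis i 1))) / w ^ 3"
    by (simp add: sum_subtractf sum_divide_distrib)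
  also have "(\<Sum>i\<in>UNIV. p $ i * (p \<bullet> H (axis i 1))) = D2 p p"
  proof -
    have pH: "p \<bullet> H \<xi> = D2 \<xi> p" for \<xi>
    proof -
      have "D2 \<xi> p = D2 \<xi> (\<Sum>i\<in>UNIV. p $ i *\<^sub>R axis i 1)" by (simp add: sum_axis_component)
      also have "\<dots> = p \<bullet> H \<xi>"
        by (simp add: blinfun.sum_right blinfun.scaleR_right H_def inner_vec_def)
      finally show ?thesis by simp
    qed
    have "D2 p p = D2 (\<Sum>i\<in>UNIV. p $ i *\<^sub>R axis i 1) p" by (simp add: sum_axis_component)
    also have "\<dots> = (\<Sum>i\<in>UNIV. p $ i * D2 (axis i 1) p)"
      by (simp add: blinfun.sum_right blinfun.sum_left blinfun.scaleR_right blinfun.scaleR_left)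
    finally show ?thesis by (simp add: pH)
  qed
  finally show ?thesis
    using w(1) by (simp add: field_simps power3_eq_cube power2_eq_square)
qed

text \<open>The coefficient matrix I - p p^T / w^2 is positive definite, so it has a square root
  with columns \<open>v i\<close>. The operator is then the sum of \<open>D2 (v i) (v i)\<close>,
  and the Hessian bound at the touching point applies to each summand.\<close>

lemma mean_curvature_touching_from_above_by_radial:
  fixes f :: "real ^ 'n \<Rightarrow> real" and W s :: "real \<Rightarrow> real"
    and D :: "(real ^ 'n) \<Rightarrow> (real ^ 'n) \<Rightarrow>\<^sub>L real" and D2 :: "(real ^ 'n) \<Rightarrow>\<^sub>L (real ^ 'n) \<Rightarrow>\<^sub>L real"
  assumes S: "open S" "x0 \<in> S"
    and f: "\<And>x. x \<in> S \<Longrightarrow> (f has_derivative blinfun_apply (D x)) (at x)"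
    and D: "(D has_derivative blinfun_apply D2) (at x0)"
    and W: "\<And>x. x \<in> S \<Longrightarrow> (W has_real_derivative s (x \<bullet> x) / 2) (at (x \<bullet> x))"
    and s: "(s has_real_derivative s') (at (x0 \<bullet> x0))"
    and max: "\<And>x. x \<in> S \<Longrightarrow> f x - W (x \<bullet> x) \<le> f x0 - W (x0 \<bullet> x0)"
  defines "q \<equiv> x0 \<bullet> x0"
  defines "w \<equiv> sqrt (1 + (s q)\<^sup>2 * q)"
  shows "w * divergence (\<lambda>y. gradient f y /\<^sub>R sqrt (1 + (norm (gradient f y))\<^sup>2)) x0 \<le>
    2 * q * s' / w\<^sup>2 + s q * (real CARD('n) - 1 + 1 / w\<^sup>2)"
proof -
  note touch = touching_from_above_by_radial[OF S f D W s max, folded q_def]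
  define p where "p = gradient f x0"
  have p: "p = s q *\<^sub>R x0"
    using frechet_derivative_at[OF f[OF S(2)]] touch(1)
    by (simp add: p_def gradient_def vec_eq_iff inner_axis)
  have pp: "p \<bullet> p = (s q)\<^sup>2 * q" by (simp add: p q_def power2_eq_square)
  have w: "w \<ge> 1" "w\<^sup>2 = 1 + (s q)\<^sup>2 * q"
    unfolding w_def by (auto simp: q_def)
  \<comment> \<open>Since |p|^2 = w^2 - 1, this is (1 - 1 / w) / |p|^2, the solution of 2 \<beta> -
    \<beta>^2 |p|^2 = 1 / w^2 that makes the square root scale p by 1 / w; in this form it makes
    sense for p = 0 too.\<close>
  define \<beta> where "\<beta> = 1 / (w * (w + 1))"
  have \<beta>p: "\<beta> * (p \<bullet> p) = 1 - 1 / w"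
  proof -
    have "p \<bullet> p = (w - 1) * (w + 1)" using w by (simp add: pp power2_eq_square algebra_simps)
    then have "\<beta> * (p \<bullet> p) = 1 / (w * (w + 1)) * ((w - 1) * (w + 1))" by (simp only: \<beta>_def)
    also have "\<dots> = 1 - 1 / w" using w(1) by (simp add: divide_simps) (simp add: algebra_simps)?
    finally show ?thesis .
  qed
  have \<beta>: "2 * \<beta> - \<beta>\<^sup>2 * (p \<bullet> p) = 1 / w\<^sup>2"
  proof -
    have "2 * \<beta> - \<beta>\<^sup>2 * (p \<bullet> p) = \<beta> * (2 - \<beta> * (p \<bullet> p))" by (simp add: power2_eq_square algebra_simps)
    also have "\<dots> = \<beta> * ((w + 1) / w)" unfolding \<beta>p using w(1) by (simp add: field_simps)
    also have "\<dots> = 1 / w\<^sup>2" using w(1) by (simp add: \<beta>_def power2_eq_square add_eq_0_iff)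
    finally show ?thesis .
  qed
  define v where "v i = axis i 1 - (\<beta> * p $ i) *\<^sub>R p" for i
  \<comment> \<open>The trace of I - p p^T / w^2.\<close>
  have vv: "(\<Sum>i\<in>UNIV. v i \<bullet> v i) = real CARD('n) - 1 + 1 / w\<^sup>2"
  proof -
    have "v i \<bullet> v i = 1 - 1 / w\<^sup>2 * (p $ i * p $ i)" for i
      unfolding \<beta>[symmetric]
      by (simp add: v_def inner_simps inner_axis inner_axis' inner_commute algebra_simps power2_eq_square)
    then have "(\<Sum>i\<in>UNIV. v i \<bullet> v i) = real CARD('n) - (1 / w\<^sup>2) * (p \<bullet> p)"
      by (simp add: sum_subtractf inner_vec_def flip: sum_divide_distrib)
    also have "(1 / w\<^sup>2) * (p \<bullet> p) = 1 - 1 / w\<^sup>2"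
    proof -
      have "p \<bullet> p = w\<^sup>2 - 1" by (simp add: pp w)
      then show ?thesis using w(1) by (simp add: field_simps)
    qed
    finally show ?thesis by simp
  qed
  have xv: "(\<Sum>i\<in>UNIV. (x0 \<bullet> v i)\<^sup>2) = q / w\<^sup>2"
  proof -
    \<comment> \<open>As p is a multiple of \<open>x0\<close>, the square root scales
      \<open>x0\<close> by 1 / w.\<close>
    have "x0 \<bullet> v i = x0 $ i / w" for i
    proof -
      have "x0 \<bullet> v i = x0 $ i - \<beta> * (p \<bullet> p) * x0 $ i"
        by (simp add: v_def inner_diff_right inner_axis p)
      then show ?thesis by (simp add: \<beta>p algebra_simps)
    qed
    then show ?thesis
      by (simp add: power_divide q_def inner_vec_def power2_eq_square flip: sum_divide_distrib)
  qed
  have "w * divergence (\<lambda>y. gradient f y /\<^sub>R sqrt (1 + (norm (gradient f y))\<^sup>2)) x0 =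
      (\<Sum>i\<in>UNIV. D2 (v i) (v i))"
    using divergence_unit_normal[OF S f D] trace_rank_one_perturbation[where B = D2 and p = p and \<beta> = \<beta>]
    by (simp add: \<beta> v_def w_def flip: p_def pp)
  also have "\<dots> \<le> (\<Sum>i\<in>UNIV. 2 * s' * (x0 \<bullet> v i)\<^sup>2 + s q * (v i \<bullet> v i))"
    by (intro sum_mono touch(2))
  also have "\<dots> = 2 * s' * (q / w\<^sup>2) + s q * (real CARD('n) - 1 + 1 / w\<^sup>2)"
    by (simp add: sum.distrib vv xv flip: sum_distrib_left)
  finally show ?thesis by (simp add: ac_simps)
qed

section \<open>The barrier: supersolution property and boundary behaviour\<close>

text \<open>In terms of \<open>q = |x|\<^sup>2\<close>; the logarithm is \<open>2 arcosh (|x| / a)\<close> up to a constant, i.e. the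
  profile of the two-dimensional catenoid, which is a supersolution in every dimension.\<close>

definition barrier :: "real \<Rightarrow> real \<Rightarrow> real \<Rightarrow> real"
  where "barrier k a q = k / 2 * (q - 1) -
    a / 2 * (ln (2 * q - a\<^sup>2 + 2 * sqrt (q\<^sup>2 - a\<^sup>2 * q)) - ln (2 - a\<^sup>2 + 2 * sqrt (1 - a\<^sup>2)))"

text \<open>Twice the derivative of the barrier in q, so that the gradient of x \<mapsto>
  barrier(|x|^2) is the slope times x. With r = |x|, the subtracted term is the catenoid slope a /
  sqrt(r^2 - a^2) divided by r.\<close>

definition barrier_slope :: "real \<Rightarrow> real \<Rightarrow> real \<Rightarrow> real"
  where "barrier_slope k a q = k - a / sqrt (q\<^sup>2 - a\<^sup>2 * q)"

lemma radicand_pos: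
  fixes a q :: real
  assumes "a\<^sup>2 < q"
  shows "0 < q" "0 < q\<^sup>2 - a\<^sup>2 * q"
proof -
  show "0 < q" using assms zero_le_power2[of a] by linarith
  then have "0 < q * (q - a\<^sup>2)" using assms by simp
  then show "0 < q\<^sup>2 - a\<^sup>2 * q" by (simp add: power2_eq_square algebra_simps)
qed

lemma has_derivative_sqrt_radicand:
  fixes a q :: real
  assumes "a\<^sup>2 < q"
  shows "((\<lambda>q. sqrt (q\<^sup>2 - a\<^sup>2 * q)) has_real_derivative
    (2 * q - a\<^sup>2) / (2 * sqrt (q\<^sup>2 - a\<^sup>2 * q))) (at q)"
proof -
  have "((\<lambda>q. q\<^sup>2 - a\<^sup>2 * q) has_real_derivative 2 * q - a\<^sup>2) (at q)"
    by (auto intro!: derivative_eq_intros)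
  from DERIV_chain2[OF DERIV_real_sqrt[OF radicand_pos(2)[OF assms]] this]
  show ?thesis by (rule DERIV_cong) (simp add: field_simps)
qed

lemma has_derivative_barrier:
  assumes "a\<^sup>2 < q"
  shows "(barrier k a has_real_derivative barrier_slope k a q / 2) (at q)"
proof -
  define R where "R = (\<lambda>q. sqrt (q\<^sup>2 - a\<^sup>2 * q))"
  have R: "R q > 0" using radicand_pos[OF assms] by (simp add: R_def)
  have arg: "2 * q - a\<^sup>2 + 2 * R q > 0"
    using assms R radicand_pos(1)[OF assms] by linarith
  have "((\<lambda>q. 2 * q - a\<^sup>2 + 2 * R q) has_real_derivative
      2 * 1 - 0 + 2 * ((2 * q - a\<^sup>2) / (2 * R q))) (at q)"
    unfolding R_def by (intro DERIV_add DERIV_diff DERIV_cmult DERIV_ident DERIV_const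
        has_derivative_sqrt_radicand assms)
  from DERIV_chain2[OF DERIV_ln_divide[OF arg] this]
  have dln: "((\<lambda>q. ln (2 * q - a\<^sup>2 + 2 * R q)) has_real_derivative 1 / R q) (at q)"
  proof (rule DERIV_cong)
    have "2 * 1 - 0 + 2 * ((2 * q - a\<^sup>2) / (2 * R q)) = (2 * q - a\<^sup>2 + 2 * R q) / R q"
      using R by (simp add: field_simps)
    then show "1 / (2 * q - a\<^sup>2 + 2 * R q) * (2 * 1 - 0 + 2 * ((2 * q - a\<^sup>2) / (2 * R q))) = 1 / R q"
      using arg by simp
  qed
  have "((\<lambda>q. k / 2 * (q - 1) - a / 2 * (ln (2 * q - a\<^sup>2 + 2 * R q) - ln (2 - a\<^sup>2 + 2 * sqrt (1 - a\<^sup>2))))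
      has_real_derivative k / 2 * (1 - 0) - a / 2 * (1 / R q - 0)) (at q)"
    by (intro DERIV_diff DERIV_cmult DERIV_ident DERIV_const dln)
  then show ?thesis
    unfolding barrier_def[abs_def] barrier_slope_def R_def
    by (rule DERIV_cong) (simp add: diff_divide_distrib)
qed

lemma has_derivative_barrier_slope:
  assumes "a\<^sup>2 < q"
  shows "(barrier_slope k a has_real_derivative
    a * (2 * q - a\<^sup>2) / (2 * sqrt (q\<^sup>2 - a\<^sup>2 * q) ^ 3)) (at q)"
proof -
  have "sqrt (q\<^sup>2 - a\<^sup>2 * q) \<noteq> 0" using radicand_pos[OF assms] by simp
  from DERIV_diff[OF DERIV_const DERIV_divide[OF DERIV_const has_derivative_sqrt_radicand[OF assms] this]]
  show ?thesis
    unfolding barrier_slope_def[abs_def] by (rule DERIV_cong) (simp add: power3_eq_cube)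
qed

text \<open>The endpoint q = a^2 is included: the slope blows up there, but the argument of the
  logarithm is still a^2 > 0. This gives a maximum on the closed annulus.\<close>

lemma continuous_on_barrier:
  assumes "0 < a"
  shows "continuous_on {a\<^sup>2..} (barrier k a)"
proof -
  have "2 * q - a\<^sup>2 + 2 * sqrt (q\<^sup>2 - a\<^sup>2 * q) > 0" if "a\<^sup>2 \<le> q" for q
  proof -
    have "0 < a\<^sup>2" using assms by simp
    moreover have "0 \<le> q * (q - a\<^sup>2)"
      using that calculation by (intro mult_nonneg_nonneg) linarith+
    then have "0 \<le> sqrt (q\<^sup>2 - a\<^sup>2 * q)" by (simp add: power2_eq_square algebra_simps)
    ultimately show ?thesis using that by linarith
  qed
  then show ?thesis
    unfolding barrier_def by (intro continuous_intros) force+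
qed

text \<open>The catenoid has zero curvature in dimension two, so for n = 2 every surviving term
  carries a factor \<open>k\<close>; the extra n - 2 dimensions contribute a multiple of
  \<open>s\<close>, which is below \<open>k\<close>. Everything is thus at most a constant times
  \<open>k w\<^sup>2\<close>, however steep the barrier.\<close>

lemma barrier_supersolution:
  fixes n h a q :: real
  assumes n: "2 \<le> n" and h: "0 < h" and a: "0 < a" and q: "a\<^sup>2 < q" "q \<le> 1"
  defines "k \<equiv> min h 1 / 4"
  defines "s \<equiv> barrier_slope k a q"
  defines "w \<equiv> sqrt (1 + s\<^sup>2 * q)"
  shows "2 * q * (a * (2 * q - a\<^sup>2) / (2 * sqrt (q\<^sup>2 - a\<^sup>2 * q) ^ 3)) / w\<^sup>2
    + s * (n - 1 + 1 / w\<^sup>2) < n * h * w"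
proof -
  define R where "R = sqrt (q\<^sup>2 - a\<^sup>2 * q)"
  define G where "G = a / R"
  note pos = radicand_pos[OF q(1)]
  have R: "R > 0" "R\<^sup>2 = q * (q - a\<^sup>2)"
    using pos by (auto simp: R_def power2_eq_square algebra_simps)
  have G: "G > 0" "G\<^sup>2 * q = a\<^sup>2 / (q - a\<^sup>2)" "s = k - G"
    using R a pos by (auto simp: G_def power_divide s_def barrier_slope_def R_def)
  have k: "0 < k" "k \<le> 1 / 4" "4 * k \<le> h" using h by (auto simp: k_def)
  have w: "w \<ge> 1" "w\<^sup>2 = 1 + s\<^sup>2 * q"
    unfolding w_def using pos by auto
  have 1: "2 * q * (a * (2 * q - a\<^sup>2) / (2 * R ^ 3)) = G * (2 + G\<^sup>2 * q)"
  proof -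
    have "2 * q * (a * (2 * q - a\<^sup>2) / (2 * R ^ 3)) = G * (q * (2 * q - a\<^sup>2) / R\<^sup>2)"
      by (simp add: G_def power3_eq_cube power2_eq_square)
    also have "q * (2 * q - a\<^sup>2) / R\<^sup>2 = (2 * q - a\<^sup>2) / (q - a\<^sup>2)"
      using pos by (simp add: R)
    also have "\<dots> = 2 + G\<^sup>2 * q"
      unfolding G(2) using q(1) by (simp add: field_simps)
    finally show ?thesis .
  qed
  \<comment> \<open>Substituting G = k - s cancels the cubic terms q s^3 and the linear terms 2 s,
    leaving growth at most quadratic in \<open>s\<close> outside the n - 2 term.\<close>
  have "G * (2 + G\<^sup>2 * q) + s * ((n - 1) * w\<^sup>2 + 1) =
      (n - 2) * s * w\<^sup>2 + 2 * k + q * k * (k\<^sup>2 - 3 * k * s + 3 * s\<^sup>2)"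
    unfolding w(2) using G(3) by algebra
  also have "\<dots> \<le> (n - 2) * k * w\<^sup>2 + 2 * k + k * (5 / 2 * k\<^sup>2 + 9 / 2 * (s\<^sup>2 * q))"
  proof -
    \<comment> \<open>This controls the mixed term -3 k s, whose sign is unknown because
      \<open>s\<close> may be very negative.\<close>
    have "0 \<le> (k + s)\<^sup>2" by simp
    then have "k\<^sup>2 - 3 * k * s + 3 * s\<^sup>2 \<le> 5 / 2 * k\<^sup>2 + 9 / 2 * s\<^sup>2"
      by (simp add: power2_eq_square algebra_simps)
    then have "q * (k\<^sup>2 - 3 * k * s + 3 * s\<^sup>2) \<le> q * (5 / 2 * k\<^sup>2 + 9 / 2 * s\<^sup>2)"
      using pos by simp
    also have "\<dots> \<le> 5 / 2 * k\<^sup>2 + 9 / 2 * (s\<^sup>2 * q)"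
      using mult_right_mono[OF q(2), of "k\<^sup>2"] by (simp add: algebra_simps)
    finally have "k * (q * (k\<^sup>2 - 3 * k * s + 3 * s\<^sup>2)) \<le> k * (5 / 2 * k\<^sup>2 + 9 / 2 * (s\<^sup>2 * q))"
      using k by simp
    moreover have "(n - 2) * s * w\<^sup>2 \<le> (n - 2) * k * w\<^sup>2"
      using n G by (intro mult_right_mono mult_left_mono) auto
    ultimately show ?thesis by (simp add: ac_simps)
  qed
  also have "\<dots> \<le> (n - 2) * k * w\<^sup>2 + 5 * k * w\<^sup>2"
  proof -
    have "k\<^sup>2 \<le> (1 / 4)\<^sup>2" using k by (intro power_mono) auto
    moreover have "0 \<le> s\<^sup>2 * q" using pos by simp
    ultimately have "2 + 5 / 2 * k\<^sup>2 + 9 / 2 * (s\<^sup>2 * q) \<le> 5 * w\<^sup>2"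
      unfolding w(2) by (simp add: power_divide)
    from mult_left_mono[OF this, of k] k show ?thesis by (simp add: algebra_simps)
  qed
  also have "\<dots> = (n + 3) * k * w\<^sup>2" by (simp add: algebra_simps)
  also have "\<dots> < n * h * w * w\<^sup>2"
  proof (rule mult_strict_right_mono)
    \<comment> \<open>Strictness comes from n + 3 < 4 n; the factor 1/4 in \<open>k\<close> then
      gives 4 k \<le> h.\<close>
    have "(n + 3) * k < 4 * n * k" using n k by (intro mult_strict_right_mono) auto
    also have "\<dots> \<le> n * h" using k n mult_left_mono[of "4 * k" h n] by simp
    also have "\<dots> \<le> n * h * w" using n h w mult_left_mono[of 1 w "n * h"] by simp
    finally show "(n + 3) * k < n * h * w" .
  qed (use w(1) in auto)
  finally have "(G * (2 + G\<^sup>2 * q) + s * ((n - 1) * w\<^sup>2 + 1)) / w\<^sup>2 < n * h * w"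
    using w(1) by (simp add: pos_divide_less_eq)
  moreover have "(G * (2 + G\<^sup>2 * q) + s * ((n - 1) * w\<^sup>2 + 1)) / w\<^sup>2 =
      G * (2 + G\<^sup>2 * q) / w\<^sup>2 + s * (n - 1 + 1 / w\<^sup>2)"
    using w(1) by (simp add: field_simps)
  ultimately show ?thesis unfolding R_def[symmetric] 1 by simp
qed

text \<open>Along the ray |x| = (1 + t) a the logarithm becomes ln(a^2) + L(t), where L(t) = 2
  arcosh(1 + t) behaves like 2 sqrt(2 t). Hence L(t) / t tends to infinity, while the paraboloid
  contributes a bounded quotient.\<close>

lemma barrier_inner_slope:
  assumes "0 < a"
  shows "filterlim (\<lambda>t. (barrier k a ((1 + t)\<^sup>2 * a\<^sup>2) - barrier k a (a\<^sup>2)) / t) at_bot (at_right 0)"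
proof -
  define L :: "real \<Rightarrow> real" where "L t = ln (2 * (1 + t)\<^sup>2 - 1 + 2 * ((1 + t) * sqrt (2 * t + t\<^sup>2)))" for t
  have "(barrier k a ((1 + t)\<^sup>2 * a\<^sup>2) - barrier k a (a\<^sup>2)) / t
      = k / 2 * a\<^sup>2 * (2 + t) - a / 2 * (L t / t)" if "t > 0" for t
  proof -
    have "sqrt (((1 + t)\<^sup>2 * a\<^sup>2)\<^sup>2 - a\<^sup>2 * ((1 + t)\<^sup>2 * a\<^sup>2)) = sqrt ((a\<^sup>2 * (1 + t))\<^sup>2 * (2 * t + t\<^sup>2))"
      by (rule arg_cong[of _ _ sqrt]) (simp add: power2_eq_square algebra_simps)
    also have "\<dots> = a\<^sup>2 * ((1 + t) * sqrt (2 * t + t\<^sup>2))"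
      using that assms by (simp add: real_sqrt_mult)
    finally have "2 * ((1 + t)\<^sup>2 * a\<^sup>2) - a\<^sup>2 + 2 * sqrt (((1 + t)\<^sup>2 * a\<^sup>2)\<^sup>2 - a\<^sup>2 * ((1 + t)\<^sup>2 * a\<^sup>2))
      = a\<^sup>2 * (2 * (1 + t)\<^sup>2 - 1 + 2 * ((1 + t) * sqrt (2 * t + t\<^sup>2)))"
      by (simp add: algebra_simps)
    moreover have "2 * (1 + t)\<^sup>2 - 1 + 2 * ((1 + t) * sqrt (2 * t + t\<^sup>2)) > 0"
    proof -
      have "(1 + t)\<^sup>2 \<ge> 1" using that by simp
      moreover have "(1 + t) * sqrt (2 * t + t\<^sup>2) \<ge> 0" using that by simp
      ultimately show ?thesis by linarith
    qed
    ultimately have "ln (2 * ((1 + t)\<^sup>2 * a\<^sup>2) - a\<^sup>2 +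
        2 * sqrt (((1 + t)\<^sup>2 * a\<^sup>2)\<^sup>2 - a\<^sup>2 * ((1 + t)\<^sup>2 * a\<^sup>2))) = ln (a\<^sup>2) + L t"
      using assms by (simp add: L_def ln_mult)
    then have eq: "barrier k a ((1 + t)\<^sup>2 * a\<^sup>2) - barrier k a (a\<^sup>2)
        = k / 2 * a\<^sup>2 * (2 * t + t\<^sup>2) - a / 2 * L t"
      by (simp add: barrier_def power2_eq_square[of "a\<^sup>2"]) (simp add: power2_eq_square field_simps)
    show ?thesis unfolding eq using that by (simp add: power2_eq_square field_simps)
  qed
  then have "\<forall>\<^sub>F t in at_right 0. k / 2 * a\<^sup>2 * (2 + t) - a / 2 * (L t / t) =
      (barrier k a ((1 + t)\<^sup>2 * a\<^sup>2) - barrier k a (a\<^sup>2)) / t"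
    by (auto simp: eventually_at_filter)
  moreover have "filterlim (\<lambda>t. k / 2 * a\<^sup>2 * (2 + t) - a / 2 * (L t / t)) at_bot (at_right 0)"
  proof -
    have "filterlim (\<lambda>t. L t / t) at_top (at_right 0)"
      unfolding L_def by real_asymp
    then have "filterlim (\<lambda>t. a / 2 * (L t / t)) at_top (at_right 0)"
      using assms by (intro filterlim_tendsto_pos_mult_at_top[OF tendsto_const]) auto
    moreover have "((\<lambda>t. - (k / 2 * a\<^sup>2 * (2 + t))) \<longlongrightarrow> - (k / 2 * a\<^sup>2 * (2 + 0))) (at_right 0)"
      by (intro tendsto_intros)
    ultimately have "filterlim (\<lambda>t. - (k / 2 * a\<^sup>2 * (2 + t)) + a / 2 * (L t / t)) at_top (at_right 0)"
      by (rule filterlim_tendsto_add_at_top[rotated])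
    then show ?thesis by (simp add: filterlim_uminus_at_bot)
  qed
  ultimately show ?thesis by (rule filterlim_cong[OF refl refl, THEN iffD1])
qed

text \<open>Since a ln a tends to 0, the catenoid height vanishes and only the paraboloid value -k /
  2 remains in the limit.\<close>

lemma barrier_inner_height:
  assumes "0 < k"
  shows "\<forall>\<^sub>F a in at_right 0. barrier k a (a\<^sup>2) < - k / 4"
proof -
  have "((\<lambda>a. k / 2 * (a\<^sup>2 - 1) - a / 2 * (ln (a\<^sup>2) - ln (2 - a\<^sup>2 + 2 * sqrt (1 - a\<^sup>2)))) \<longlongrightarrow> - k / 2)
      (at_right 0)"
    by real_asymp
  then have "((\<lambda>a. barrier k a (a\<^sup>2)) \<longlongrightarrow> - k / 2) (at_right 0)"
    by (simp add: barrier_def power2_eq_square[of "_\<^sup>2"])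
  then show ?thesis by (rule order_tendstoD) (use assms in simp)
qed

section \<open>Closure and frontier of the annulus\<close>

lemma open_annulus: "open (annulus \<epsilon> :: (real ^ 'n) set)"
proof -
  have "(annulus \<epsilon> :: (real ^ 'n) set) = - cball 0 \<epsilon> \<inter> ball 0 1"
    by (auto simp: annulus_def)
  then show ?thesis by auto
qed

lemma closed_annulus_subset_closure:
  fixes x :: "real ^ 'n"
  assumes "0 < \<epsilon>" "\<epsilon> < 1" "\<epsilon> \<le> norm x" "norm x \<le> 1"
  shows "x \<in> closure (annulus \<epsilon>)"
proof -
  define m where "m = (1 + \<epsilon>) / 2"
  \<comment> \<open>The point x is moved radially the fraction t of the way to the middle radius
    \<open>m\<close>; for 0 < t < 1 this is strictly inside.\<close>
  define y where "y t = (((1 - t) * norm x + t * m) / norm x) *\<^sub>R x" for t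
  have x: "norm x > 0" using assms by linarith
  have "(y \<longlongrightarrow> (((1 - 0) * norm x + 0 * m) / norm x) *\<^sub>R x) (at_right 0)"
    unfolding y_def using x by (intro tendsto_intros) auto
  then have "(y \<longlongrightarrow> x) (at_right 0)" using x by simp
  moreover have "\<forall>\<^sub>F t in at_right 0. y t \<in> closure (annulus \<epsilon>)"
  proof -
    have "y t \<in> annulus \<epsilon>" if "0 < t" "t < 1" for t
    proof -
      have m: "\<epsilon> < m" "m < 1" using assms by (auto simp: m_def)
      have e: "(1 - t) * \<epsilon> \<le> (1 - t) * norm x" "t * \<epsilon> < t * m"
          "(1 - t) * norm x \<le> (1 - t) * 1" "t * m < t * 1"
        using that m assms by (intro mult_left_mono mult_strict_left_mono; simp)+
      then have "\<epsilon> < (1 - t) * norm x + t * m" "(1 - t) * norm x + t * m < 1"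
        by (auto simp: algebra_simps)
      moreover from this have "norm (y t) = (1 - t) * norm x + t * m"
        using x assms(1) by (simp add: y_def)
      ultimately show ?thesis by (simp add: annulus_def)
    qed
    then show ?thesis
      using closure_subset by (auto simp: eventually_at_right_field intro!: exI[of _ 1])
  qed
  ultimately show ?thesis
    by (intro Lim_in_closed_set[of _ y "at_right 0" x]) auto
qed

lemma spheres_subset_frontier:
  fixes x :: "real ^ 'n"
  assumes "0 < \<epsilon>" "\<epsilon> < 1" "norm x = \<epsilon> \<or> norm x = 1"
  shows "x \<in> frontier (annulus \<epsilon>)"
proof -
  have "x \<in> closure (annulus \<epsilon>)"
    using assms by (intro closed_annulus_subset_closure) auto
  moreover have "x \<notin> annulus \<epsilon>" using assms(3) by (auto simp: annulus_def)
  ultimately show ?thesis by (simp add: frontier_def interior_open open_annulus)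
qed

section \<open>Comparison with the barrier and the contradiction\<close>

lemma below_barrier:
  fixes f :: "real ^ 'n \<Rightarrow> real" and h \<epsilon> a :: real
  assumes n: "CARD('n) \<ge> 2" and h: "h > 0" and \<epsilon>: "0 < \<epsilon>" "\<epsilon> < a" and a: "a < 1"
    and C2: "C2_on f (annulus \<epsilon>)"
    and cont: "continuous_on (closure (annulus \<epsilon>)) f"
    and cmc: "graph_has_constant_mean_curvature f (annulus \<epsilon>) h"
    and bdry: "\<And>x. norm x = 1 \<Longrightarrow> f x = 0"
    and x: "a \<le> norm x" "norm x \<le> 1"
  shows "f x \<le> barrier (min h 1 / 4) a (x \<bullet> x)"
proof -
  define k where "k = min h 1 / 4"
  define K :: "(real ^ 'n) set" where "K = {x. a \<le> norm x \<and> norm x \<le> 1}"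
  define \<phi> where "\<phi> x = f x - barrier k a (x \<bullet> x)" for x
  have "a > 0" using \<epsilon> by simp
  have normK: "a\<^sup>2 \<le> x \<bullet> x" if "x \<in> K" for x
    using that \<open>a > 0\<close> by (auto simp: K_def dot_square_norm intro: power_mono)
  obtain D D2 where D: "\<And>x. x \<in> annulus \<epsilon> \<Longrightarrow> (f has_derivative blinfun_apply (D x)) (at x)"
    and D2: "\<And>x. x \<in> annulus \<epsilon> \<Longrightarrow> (D has_derivative blinfun_apply (D2 x)) (at x)"
    using C2 unfolding C2_on_def by blast
  have K: "compact K"
  proof -
    have "K = cball 0 1 - ball 0 a" by (auto simp: K_def)
    then show ?thesis by (simp add: compact_diff)
  qed
  have cont\<phi>: "continuous_on K \<phi>"
  proof -
    have "K \<subseteq> closure (annulus \<epsilon>)"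
      using \<epsilon> a by (auto simp: K_def intro!: closed_annulus_subset_closure)
    from continuous_on_subset[OF cont this] show ?thesis
      unfolding \<phi>_def using normK
      by (intro continuous_intros continuous_on_compose2[OF continuous_on_barrier[OF \<open>a > 0\<close>]]) auto
  qed
  have "x \<in> K" using x by (simp add: K_def)
  then obtain x0 where x0: "x0 \<in> K" "\<And>y. y \<in> K \<Longrightarrow> \<phi> y \<le> \<phi> x0"
    using continuous_attains_sup[OF K _ cont\<phi>] by blast
  consider "norm x0 = 1" | "norm x0 = a" | "x0 \<in> annulus a"
    using x0(1) by (force simp: K_def annulus_def)
  then have "\<phi> x0 \<le> 0"
  proof cases
    case 1
    \<comment> \<open>Both \<open>f\<close> and the barrier vanish on the unit sphere.\<close>
    then show ?thesis using bdry[of x0] by (simp add: \<phi>_def barrier_def dot_square_norm)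
  next
    case 2
    \<comment> \<open>\<open>u\<close> and \<open>v\<close> are outward radial difference quotients
      of \<open>f\<close> and of the barrier. Maximality at \<open>x0\<close> forces u \<le> v, but
      \<open>u\<close> has a finite limit and \<open>v\<close> tends to minus infinity.\<close>
    define u where "u t = (f ((1 + t) *\<^sub>R x0) - f x0) / t" for t
    define v where "v t = (barrier k a ((1 + t)\<^sup>2 * a\<^sup>2) - barrier k a (a\<^sup>2)) / t" for t
    have "x0 \<in> annulus \<epsilon>" using 2 \<epsilon> a by (simp add: annulus_def)
    then have df: "(f has_derivative blinfun_apply (D x0)) (at x0)" by (rule D)
    have "((\<lambda>t. (1 + t) *\<^sub>R x0) has_derivative (\<lambda>t. t *\<^sub>R x0)) (at 0)"
      by (auto intro!: derivative_eq_intros)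
    from has_derivative_compose[OF this, of f "blinfun_apply (D x0)"] df
    have "((\<lambda>t. f ((1 + t) *\<^sub>R x0)) has_real_derivative D x0 x0) (at 0)"
      by (simp add: has_field_derivative_def blinfun.scaleR_right mult_commute_abs)
    then have "(u \<longlongrightarrow> D x0 x0) (at_right 0)"
      unfolding u_def DERIV_def by (auto intro: tendsto_within_subset)
    then have "\<forall>\<^sub>F t in at_right 0. D x0 x0 - 1 < u t"
      by (rule order_tendstoD) simp
    moreover have "\<forall>\<^sub>F t in at_right 0. v t < D x0 x0 - 1"
      using barrier_inner_slope[OF \<open>a > 0\<close>, of k] unfolding v_def filterlim_at_bot_dense by blast
    moreover have "\<forall>\<^sub>F t in at_right 0. u t \<le> v t"
    proof -
      \<comment> \<open>The bound on \<open>t\<close> keeps (1 + t) x0 inside the unit ball, hence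
        in \<open>K\<close>.\<close>
      have "u t \<le> v t" if "0 < t" "t < 1 / a - 1" for t
      proof -
        have "(1 + t) * a \<le> 1" using that \<open>a > 0\<close> by (simp add: field_simps)
        moreover have "a \<le> (1 + t) * a" using that \<open>a > 0\<close> by simp
        ultimately have "(1 + t) *\<^sub>R x0 \<in> K" using 2 that by (simp add: K_def)
        from x0(2)[OF this] have "f ((1 + t) *\<^sub>R x0) - f x0
            \<le> barrier k a ((1 + t)\<^sup>2 * a\<^sup>2) - barrier k a (a\<^sup>2)"
          using 2 by (simp add: \<phi>_def dot_square_norm power_mult_distrib
              flip: power2_eq_square mult.assoc)
        then show ?thesis using that by (simp add: u_def v_def divide_right_mono)
      qed
      moreover have "0 < 1 / a - 1" using a \<open>a > 0\<close> by simp
      ultimately show ?thesis unfolding eventually_at_right_field by blast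
    qed
    ultimately have "\<forall>\<^sub>F t in at_right (0 :: real). False"
      by eventually_elim simp
    then show ?thesis by simp
  next
    case 3
    define q where "q = x0 \<bullet> x0"
    define s where "s = barrier_slope k a"
    define s' where "s' = a * (2 * q - a\<^sup>2) / (2 * sqrt (q\<^sup>2 - a\<^sup>2 * q) ^ 3)"
    define w where "w = sqrt (1 + (s q)\<^sup>2 * q)"
    have sub: "annulus a \<subseteq> (annulus \<epsilon> :: (real ^ 'n) set)" "annulus a \<subseteq> K"
      using \<epsilon> by (auto simp: annulus_def K_def)
    have inner: "a\<^sup>2 < y \<bullet> y" if "y \<in> annulus a" for y :: "real ^ 'n"
      using that \<open>a > 0\<close> by (auto simp: annulus_def dot_square_norm intro: power_strict_mono)
    have q: "a\<^sup>2 < q" "q \<le> 1"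
      using inner[OF 3] 3 unfolding q_def
      by (auto simp: annulus_def dot_square_norm power_le_one)
    \<comment> \<open>At an interior maximum the touching estimate and the supersolution inequality
      would give w n h < n h w.\<close>
    have "w * divergence (\<lambda>y. gradient f y /\<^sub>R sqrt (1 + (norm (gradient f y))\<^sup>2)) x0 \<le>
        2 * q * s' / w\<^sup>2 + s q * (real CARD('n) - 1 + 1 / w\<^sup>2)"
      unfolding q_def w_def
    proof (rule mean_curvature_touching_from_above_by_radial[OF open_annulus 3])
      show "(D has_derivative blinfun_apply (D2 x0)) (at x0)" using D2 3 sub by auto
      show "(barrier k a has_real_derivative s (y \<bullet> y) / 2) (at (y \<bullet> y))" if "y \<in> annulus a" for y :: "real ^ 'n"
        unfolding s_def by (rule has_derivative_barrier[OF inner[OF that]])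
      show "(s has_real_derivative s') (at (x0 \<bullet> x0))"
        using has_derivative_barrier_slope[OF q(1)] by (simp add: s_def s'_def q_def)
      show "f y - barrier k a (y \<bullet> y) \<le> f x0 - barrier k a (x0 \<bullet> x0)" if "y \<in> annulus a" for y
        using x0(2)[of y] that sub by (auto simp: \<phi>_def)
    qed (use D sub in auto)
    also have "\<dots> < real CARD('n) * h * w"
      using barrier_supersolution[OF _ h \<open>a > 0\<close> q, of "real CARD('n)"] n
      by (simp add: s_def s'_def w_def k_def)
    also have "real CARD('n) * h =
        divergence (\<lambda>y. gradient f y /\<^sub>R sqrt (1 + (norm (gradient f y))\<^sup>2)) x0"
      using cmc 3 sub by (auto simp: graph_has_constant_mean_curvature_def)
    finally show ?thesis by (simp add: mult.commute)
  qed
  with x0(2)[OF \<open>x \<in> K\<close>] show ?thesis by (simp add: \<phi>_def k_def)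
qed

theorem lemma1:
  fixes h :: real
  assumes "CARD('n::finite) \<ge> 2"
    and "h > 0"
  shows "\<exists>\<epsilon>::real. 0 < \<epsilon> \<and> \<epsilon> < 1 \<and>
    \<not> (\<exists>f :: real ^ 'n \<Rightarrow> real.
          C2_on f (annulus \<epsilon>) \<and>
          continuous_on (closure (annulus \<epsilon>)) f \<and>
          graph_has_constant_mean_curvature f (annulus \<epsilon>) h \<and>
          (\<forall>x \<in> frontier (annulus \<epsilon>). f x = 0))"
proof -
  define k where "k = min h 1 / 4"
  have "k > 0" using assms by (simp add: k_def)
  from barrier_inner_height[OF this] obtain e
    where e: "0 < e" "\<And>a. 0 < a \<Longrightarrow> a < e \<Longrightarrow> barrier k a (a\<^sup>2) < - k / 4"
    by (auto simp: eventually_at_right_field)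
  \<comment> \<open>Halving leaves room for radii a > \<epsilon> tending to \<epsilon> for which the
    barrier height is still below -k / 4.\<close>
  define \<epsilon> where "\<epsilon> = min e 1 / 2"
  have \<epsilon>: "0 < \<epsilon>" "\<epsilon> < 1" "\<epsilon> < min e 1" using e(1) by (auto simp: \<epsilon>_def)
  have False
    if f: "C2_on f (annulus \<epsilon>)" "continuous_on (closure (annulus \<epsilon>)) f"
      "graph_has_constant_mean_curvature f (annulus \<epsilon>) h"
      "\<forall>x \<in> frontier (annulus \<epsilon>). f x = 0" for f :: "real ^ 'n \<Rightarrow> real"
  proof -
    \<comment> \<open>Any coordinate direction serves; \<open>undefined\<close> merely names some
      index.\<close>
    define u :: "real ^ 'n" where "u = axis undefined 1"
    have u: "norm u = 1" by (simp add: u_def)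
    have bdry: "f x = 0" if "norm x = \<epsilon> \<or> norm x = 1" for x
      using f(4) spheres_subset_frontier[OF \<epsilon>(1,2) that] by blast
    \<comment> \<open>Each radius uses its own barrier, evaluated on its inner sphere; the bound is
      uniform in \<open>a\<close> and so survives the limit.\<close>
    have "f (a *\<^sub>R u) \<le> - k / 4" if a: "\<epsilon> < a" "a < min e 1" for a
    proof -
      have "f (a *\<^sub>R u) \<le> barrier k a ((a *\<^sub>R u) \<bullet> (a *\<^sub>R u))"
        unfolding k_def
        by (rule below_barrier[OF assms \<epsilon>(1) a(1) _ f(1-3)]) (use a \<epsilon> bdry u in auto)
      also have "(a *\<^sub>R u) \<bullet> (a *\<^sub>R u) = a\<^sup>2"
        using u by (simp add: dot_square_norm power2_eq_square)
      also have "barrier k a (a\<^sup>2) < - k / 4" using e(2)[of a] a \<epsilon> by simp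
      finally show ?thesis by simp
    qed
    then have "\<forall>\<^sub>F a in at_right \<epsilon>. f (a *\<^sub>R u) \<le> - k / 4"
      using \<epsilon>(3) unfolding eventually_at_right_field by blast
    moreover have "((\<lambda>a. f (a *\<^sub>R u)) \<longlongrightarrow> f (\<epsilon> *\<^sub>R u)) (at_right \<epsilon>)"
    proof -
      have "continuous_on {\<epsilon>..1} (\<lambda>a. f (a *\<^sub>R u))"
        using \<epsilon> u by (intro continuous_on_compose2[OF f(2)] continuous_intros)
          (auto intro!: closed_annulus_subset_closure)
      then show ?thesis
        using continuous_on_Icc_at_rightD \<epsilon>(2) by blast
    qed
    ultimately have "f (\<epsilon> *\<^sub>R u) \<le> - k / 4"
      by (intro tendsto_upperbound) auto
    moreover have "f (\<epsilon> *\<^sub>R u) = 0" using bdry \<epsilon>(1) u by simp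
    ultimately show False using \<open>k > 0\<close> by simp
  qed
  then show ?thesis using \<epsilon>(1,2) by blast
qed

end
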